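(* Let $A$ be a real $m\times n$ matrix and let switching costs be uniform, i.e. $S=(s_{ij})$ is the $n\times n$ matrix with $s_{ij}=1$ for $i\ne j$ and $s_{ii}=0$. Then the minimax value in static strategies $c\mapsto\tilde v(c)$, $c\in[0,\infty)$, is a continuous, increasing (in the weak sense, i.e. non-decreasing), concave and piecewise linear function (with finitely many pieces).
   Context: In the repeated zero-sum game with switching costs $(A,S,c)$, $c\ge0$, Player 2 (column player, minimizer) pays Player 1 (row player, maximizer) at each stage $t$ the amount $a_{i(t)j(t)}+c\,s_{j(t-1)j(t)}$, and payoffs are long-run averages. A static strategy plays the same mixed action at every stage, regardless of history. If Player 1 uses the static strategy $x\in\Delta(\{1,\dots,m\})$ and Player 2 the static strategy $y\in\Delta(\{1,\dots,n\})$, the payoff is $x^TAy+c\,y^TSy$, and the minimax value in static strategies is $$\tilde v(c)=\min_{y\in\Delta(\{1,\dots,n\})}\ \max_{x\in\Delta(\{1,\dots,m\})}\{x^TAy+c\,y^TSy\}.$$ *)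

theory Defs
  imports "HOL-Analysis.Analysis"
begin

definition mixed_actions :: "(real ^ 'k) set" where
  "mixed_actions = {x. (\<forall>i. 0 \<le> x $ i) \<and> (\<Sum>i\<in>UNIV. x $ i) = 1}"

text \<open>\<open>x\<^sup>T A y + c y\<^sup>T S y\<close>: the long-run average payoff when both players use static
  strategies (consecutive actions of the column player are then independent draws from \<open>y\<close>).\<close>

definition static_payoff ::
    "real ^ 'n ^ 'm \<Rightarrow> real ^ 'n ^ 'n \<Rightarrow> real \<Rightarrow> real ^ 'm \<Rightarrow> real ^ 'n \<Rightarrow> real" where
  "static_payoff A S c x y = x \<bullet> (A *v y) + c * (y \<bullet> (S *v y))"

text \<open>The minimax is written with Inf and Sup; the lemmas \<open>static_guarantee_is_max\<close> and
  \<open>static_value_is_min\<close> below show that both are attained.\<close>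

definition static_guarantee ::
    "real ^ 'n ^ 'm \<Rightarrow> real ^ 'n ^ 'n \<Rightarrow> real \<Rightarrow> real ^ 'n \<Rightarrow> real" where
  "static_guarantee A S c y = (SUP x\<in>mixed_actions. static_payoff A S c x y)"

definition static_value :: "real ^ 'n ^ 'm \<Rightarrow> real ^ 'n ^ 'n \<Rightarrow> real \<Rightarrow> real" where
  "static_value A S c = (INF y\<in>mixed_actions. static_guarantee A S c y)"

definition uniform_costs :: "real ^ 'n ^ 'n" where
  "uniform_costs = (\<chi> i j. if i = j then 0 else 1)"

text \<open>Linear pieces are understood as affine ones.\<close>

definition affine_piece :: "real set \<Rightarrow> (real \<Rightarrow> real) \<Rightarrow> bool" where
  "affine_piece I f \<longleftrightarrow> (\<exists>a b. \<forall>c\<in>I. f c = a * c + b)"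

text \<open>The breakpoints are \<open>0 = t 0 < \<dots> < t k\<close>; the last piece is the ray \<open>{t k..}\<close>.\<close>

definition piecewise_linear_on_nonneg :: "(real \<Rightarrow> real) \<Rightarrow> bool" where
  "piecewise_linear_on_nonneg f \<longleftrightarrow>
     (\<exists>(k::nat) t. t 0 = 0 \<and> (\<forall>i<k. t i < t (Suc i)) \<and>
        (\<forall>i<k. affine_piece {t i..t (Suc i)} f) \<and> affine_piece {t k..} f)"

lemma mixed_actions_nonempty: "(mixed_actions :: (real ^ 'k) set) \<noteq> {}"
proof -
  have "axis undefined 1 \<in> (mixed_actions :: (real ^ 'k) set)"
    by (auto simp: mixed_actions_def axis_def)
  then show ?thesis by blast
qed

lemma compact_mixed_actions: "compact (mixed_actions :: (real ^ 'k) set)"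
proof -
  have "closed ({x. \<forall>i. 0 \<le> x $ i} \<inter> {x. (\<Sum>i\<in>UNIV. x $ i) = 1} :: (real ^ 'k) set)"
    by (intro closed_Int closed_Collect_all closed_Collect_le closed_Collect_eq continuous_intros)
  moreover have "bounded (mixed_actions :: (real ^ 'k) set)"
  proof (rule boundedI)
    fix x :: "real ^ 'k" assume x: "x \<in> mixed_actions"
    have "norm x \<le> (\<Sum>i\<in>UNIV. \<bar>x $ i\<bar>)" by (rule norm_le_l1_cart)
    also have "\<dots> = 1" using x by (simp add: mixed_actions_def)
    finally show "norm x \<le> 1" .
  qed
  moreover have "(mixed_actions :: (real ^ 'k) set) =
      {x. \<forall>i. 0 \<le> x $ i} \<inter> {x. (\<Sum>i\<in>UNIV. x $ i) = 1}"
    by (auto simp: mixed_actions_def)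
  ultimately show ?thesis by (simp add: compact_eq_bounded_closed)
qed

lemma static_guarantee_is_max:
  "\<exists>x\<in>mixed_actions. static_payoff A S c x y = static_guarantee A S c y \<and>
     (\<forall>x'\<in>mixed_actions. static_payoff A S c x' y \<le> static_payoff A S c x y)"
proof -
  have "continuous_on mixed_actions (\<lambda>x. static_payoff A S c x y)"
    unfolding static_payoff_def by (intro continuous_intros)
  from continuous_attains_sup[OF compact_mixed_actions mixed_actions_nonempty this]
  obtain x where x: "x \<in> mixed_actions"
    "\<forall>x'\<in>mixed_actions. static_payoff A S c x' y \<le> static_payoff A S c x y" by blast
  then have "static_guarantee A S c y = static_payoff A S c x y"
    unfolding static_guarantee_def by (intro cSup_eq_maximum) auto
  with x show ?thesis by auto
qed

lemma static_guarantee_eq_Max: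
  "static_guarantee A S c y = (MAX i. (A *v y) $ i) + c * (y \<bullet> (S *v y))"
proof -
  let ?M = "MAX i. (A *v y) $ i"
  have "?M \<in> range (\<lambda>i. (A *v y) $ i)" by (intro Max_in) auto
  then obtain i where i: "(A *v y) $ i = ?M" by (metis imageE)
  have "axis i 1 \<in> mixed_actions"
    by (auto simp: mixed_actions_def axis_def)
  moreover have "static_payoff A S c (axis i 1) y = ?M + c * (y \<bullet> (S *v y))"
    using i by (simp add: static_payoff_def inner_axis')
  ultimately have *: "?M + c * (y \<bullet> (S *v y)) \<in> (\<lambda>x. static_payoff A S c x y) ` mixed_actions"
    by (metis imageI)
  have "x \<bullet> (A *v y) \<le> ?M" if "x \<in> mixed_actions" for x
  proof -
    have "x \<bullet> (A *v y) = (\<Sum>i\<in>UNIV. x $ i * (A *v y) $ i)" by (simp add: inner_vec_def)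
    also have "\<dots> \<le> (\<Sum>i\<in>UNIV. x $ i * ?M)"
      using that by (intro sum_mono mult_left_mono Max_ge) (auto simp: mixed_actions_def)
    also have "\<dots> = ?M" using that by (simp add: mixed_actions_def flip: sum_distrib_right)
    finally show ?thesis .
  qed
  with * show ?thesis
    unfolding static_guarantee_def
    by (intro cSup_eq_maximum) (auto simp: static_payoff_def)
qed

lemma static_value_is_min:
  fixes A :: "real ^ 'n ^ 'm"
  shows "\<exists>y\<in>mixed_actions. static_guarantee A S c y = static_value A S c \<and>
     (\<forall>y'\<in>mixed_actions. static_guarantee A S c y \<le> static_guarantee A S c y')"
proof -
  have M: "continuous_on UNIV (\<lambda>y :: real ^ 'n. MAX i\<in>I. (A *v y) $ i)"
    if "finite I" "I \<noteq> {}" for I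
    using that
  proof (induction I rule: finite_ne_induct)
    case (singleton i)
    then show ?case by (auto intro!: continuous_intros matrix_vector_mult_linear_continuous_on)
  next
    case (insert i I)
    then show ?case
      by (auto intro!: continuous_on_max continuous_on_component matrix_vector_mult_linear_continuous_on)
  qed
  have "continuous_on mixed_actions (static_guarantee A S c)"
    unfolding static_guarantee_eq_Max
    by (intro continuous_on_add continuous_on_mult continuous_on_const continuous_on_inner
        continuous_on_id matrix_vector_mult_linear_continuous_on
        continuous_on_subset[OF M]) auto
  from continuous_attains_inf[OF compact_mixed_actions mixed_actions_nonempty this]
  obtain y where y: "y \<in> mixed_actions"
    "\<forall>y'\<in>mixed_actions. static_guarantee A S c y \<le> static_guarantee A S c y'" by blast
  then have "static_value A S c = static_guarantee A S c y"
    unfolding static_value_def by (intro cInf_eq_minimum) auto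
  with y show ?thesis by auto
qed

end

theory Submission imports Defs begin

text \<open>
  Independent draws from \<open>y\<close> differ with probability \<open>1 - y \<bullet> y\<close>, so with uniform costs the column
  player minimizes \<open>max\<^sub>i (A y)\<^sub>i + c (1 - y \<bullet> y)\<close> over the simplex. The first summand is convex in
  \<open>y\<close> and the second concave, but the simplex splits into the finitely many polytopes on which a
  fixed row \<open>i\<close> is a best reply (\<open>best_reply_region\<close>). On each of these the maximum is the linear
  function \<open>(A y)\<^sub>i\<close>, so for \<open>c \<ge> 0\<close> the objective is concave there and is minimized at one of the
  finitely many points that span the polytope. These points do not depend on \<open>c\<close>. Hence there is one
  finite set \<open>E\<close> of mixed actions such that, for all \<open>c \<ge> 0\<close> at once, the value is the minimum over
  \<open>e \<in> E\<close> of the functions \<open>c \<mapsto> max\<^sub>i (A e)\<^sub>i + c (1 - e \<bullet> e)\<close>, which are affine with nonnegative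
  slope (\<open>static_value_eq_Min\<close>). All four claims hold for any such minimum.
\<close>

section \<open>Minima of finitely many affine functions of one variable\<close>

lemma continuous_on_Min:
  fixes f :: "'i \<Rightarrow> 'a::topological_space \<Rightarrow> 'b::linorder_topology"
  assumes "finite E" "E \<noteq> {}" "\<And>e. e \<in> E \<Longrightarrow> continuous_on S (f e)"
  shows "continuous_on S (\<lambda>x. MIN e\<in>E. f e x)"
  using assms
proof (induction E rule: finite_ne_induct)
  case (singleton e)
  then show ?case by simp
next
  case (insert e E)
  then show ?case by (simp add: continuous_on_min)
qed

lemma mono_on_Min:
  fixes f :: "'i \<Rightarrow> 'a::order \<Rightarrow> 'b::linorder"
  assumes "finite E" "E \<noteq> {}" "\<And>e. e \<in> E \<Longrightarrow> mono_on S (f e)"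
  shows "mono_on S (\<lambda>x. MIN e\<in>E. f e x)"
proof (rule mono_onI)
  fix x y assume xy: "x \<in> S" "y \<in> S" "x \<le> y"
  have "(MIN e\<in>E. f e y) \<in> (\<lambda>e. f e y) ` E"
    using assms(1,2) by (intro Min_in) auto
  then obtain e where e: "e \<in> E" "(MIN e\<in>E. f e y) = f e y" by auto
  have "(MIN e\<in>E. f e x) \<le> f e x" using assms(1) e by auto
  also have "\<dots> \<le> f e y" using assms(3)[OF e(1)] xy by (simp add: mono_onD)
  finally show "(MIN e\<in>E. f e x) \<le> (MIN e\<in>E. f e y)" by (simp add: e)
qed

lemma concave_on_Min:
  fixes f :: "'i \<Rightarrow> 'a::real_vector \<Rightarrow> real"
  assumes "finite E" "E \<noteq> {}" "\<And>e. e \<in> E \<Longrightarrow> concave_on S (f e)"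
  shows "concave_on S (\<lambda>x. MIN e\<in>E. f e x)"
  unfolding concave_on_iff
proof (intro conjI ballI allI impI)
  show "convex S" using assms concave_on_imp_convex by blast
next
  fix x y and u v :: real
  assume xy: "x \<in> S" "y \<in> S" and uv: "0 \<le> u" "0 \<le> v" "u + v = 1"
  let ?z = "u *\<^sub>R x + v *\<^sub>R y"
  have "(MIN e\<in>E. f e ?z) \<in> (\<lambda>e. f e ?z) ` E"
    using assms(1,2) by (intro Min_in) auto
  then obtain e where e: "e \<in> E" "(MIN e\<in>E. f e ?z) = f e ?z" by auto
  have "u * (MIN e\<in>E. f e x) + v * (MIN e\<in>E. f e y) \<le> u * f e x + v * f e y"
    using assms(1) e uv by (intro add_mono mult_left_mono) auto
  also have "\<dots> \<le> f e ?z"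
    using assms(3)[OF e(1)] xy uv by (auto simp: concave_on_iff)
  finally show "u * (MIN e\<in>E. f e x) + v * (MIN e\<in>E. f e y) \<le> (MIN e\<in>E. f e ?z)"
    by (simp add: e)
qed

text \<open>Two of the lines can exchange their order only where they cross. When no crossing point is
  interior to \<open>I\<close>, the line that is lowest at one interior point is therefore lowest on all of \<open>I\<close>.\<close>

lemma affine_piece_Min_between_crossings:
  fixes a b :: "'i \<Rightarrow> real"
  assumes E: "finite E" "E \<noteq> {}"
    and I: "convex I" "interior I \<noteq> {}"
    and no_crossing: "\<And>d e. d \<in> E \<Longrightarrow> e \<in> E \<Longrightarrow> a d \<noteq> a e \<Longrightarrow>
                        (b e - b d) / (a d - a e) \<notin> interior I"
  shows "affine_piece I (\<lambda>c. MIN e\<in>E. a e * c + b e)"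
proof -
  obtain c0 where c0: "c0 \<in> interior I" using I by auto
  have "(MIN e\<in>E. a e * c0 + b e) \<in> (\<lambda>e. a e * c0 + b e) ` E"
    using E by (intro Min_in) auto
  then obtain d where d: "d \<in> E" "(MIN e\<in>E. a e * c0 + b e) = a d * c0 + b d" by auto
  have d_le: "a d * c + b d \<le> a e * c + b e" if c: "c \<in> I" and e: "e \<in> E" for c e
  proof (rule ccontr)
    define D where "D x = (a e * x + b e) - (a d * x + b d)" for x
    assume "\<not> a d * c + b d \<le> a e * c + b e"
    then have neg: "D c < 0" by (simp add: D_def)
    have "a d * c0 + b d \<le> a e * c0 + b e"
      using E e by (simp flip: d(2))
    then have pos: "0 \<le> D c0" by (simp add: D_def)
    \<comment> \<open>The affine function \<open>D\<close> vanishes at the fraction \<open>s\<close> of the way from \<open>c\<close> to \<open>c0\<close>.\<close>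
    define s where "s = D c / (D c - D c0)"
    have s: "0 < s" "s \<le> 1" using neg pos by (auto simp: s_def divide_simps)
    have z: "c - s * (c - c0) \<in> interior I"
      using mem_interior_convex_shrink[OF I(1) c0 c s] by simp
    have "D (c - s * (c - c0)) = D c - s * (D c - D c0)"
      by (simp add: D_def algebra_simps)
    also have "\<dots> = 0" using neg pos by (simp add: s_def)
    finally have zero: "D (c - s * (c - c0)) = 0" .
    have ne: "a d \<noteq> a e" using neg pos by (auto simp: D_def)
    have "c - s * (c - c0) = (b e - b d) / (a d - a e)"
      using zero ne by (simp add: D_def eq_divide_eq) (simp add: algebra_simps)
    with z no_crossing[OF d(1) e ne] show False by simp
  qed
  have "(MIN e\<in>E. a e * c + b e) = a d * c + b d" if "c \<in> I" for c
    using E d d_le[OF that] by (intro Min_eqI) auto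
  then show ?thesis unfolding affine_piece_def by blast
qed

text \<open>The breakpoints are \<open>0\<close> and the positive crossing points, in increasing order.\<close>

lemma piecewise_linear_on_nonneg_Min:
  fixes a b :: "'i \<Rightarrow> real"
  assumes E: "finite E" "E \<noteq> {}"
  shows "piecewise_linear_on_nonneg (\<lambda>c. MIN e\<in>E. a e * c + b e)"
proof -
  define B where "B = insert 0 ({0<..} \<inter> (\<lambda>(d, e). (b e - b d) / (a d - a e)) ` (E \<times> E))"
  define ts where "ts = sorted_list_of_set B"
  define k where "k = length ts - 1"
  have fin: "finite B" using E by (simp add: B_def)
  have nonneg: "0 \<le> z" if "z \<in> B" for z using that by (auto simp: B_def)
  have set: "set ts = B" using fin by (simp add: ts_def)
  have sorted: "sorted_wrt (<) ts" by (simp add: ts_def)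
  have "ts \<noteq> []" using set by (auto simp: B_def)
  then have len: "length ts = Suc k" by (cases ts) (auto simp: k_def)
  have less: "ts ! i < ts ! j" if "i < j" "j \<le> k" for i j
    using sorted_wrt_nth_less[OF sorted] that len by simp
  have in_B: "ts ! i \<in> B" if "i \<le> k" for i
    using that len set by (metis le_imp_less_Suc nth_mem)
  have index: "\<exists>j\<le>k. z = ts ! j" if "z \<in> B" for z
    using that len set by (metis in_set_conv_nth less_Suc_eq_le)
  have t0: "ts ! 0 = 0"
  proof -
    obtain j where j: "j \<le> k" "0 = ts ! j" using index[of 0] by (auto simp: B_def)
    have "j = 0" using less[of 0 j] j nonneg[OF in_B[of 0]] by (cases j) auto
    with j show ?thesis by simp
  qed
  have crossing: "(b e - b d) / (a d - a e) \<in> B"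
    if "d \<in> E" "e \<in> E" "0 < (b e - b d) / (a d - a e)" for d e
    using that by (force simp: B_def)
  have "affine_piece {ts ! i..ts ! Suc i} (\<lambda>c. MIN e\<in>E. a e * c + b e)" if i: "i < k" for i
  proof (rule affine_piece_Min_between_crossings[OF E])
    show "interior {ts ! i..ts ! Suc i} \<noteq> {}" using less[of i "Suc i"] i by simp
    fix d e assume de: "d \<in> E" "e \<in> E"
    show "(b e - b d) / (a d - a e) \<notin> interior {ts ! i..ts ! Suc i}" (is "?z \<notin> _")
    proof
      assume "?z \<in> interior {ts ! i..ts ! Suc i}"
      then have z: "ts ! i < ?z" "?z < ts ! Suc i" by auto
      then have "?z \<in> B" using crossing[OF de] nonneg[OF in_B[of i]] i by simp
      then obtain j where j: "j \<le> k" "?z = ts ! j" using index by blast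
      have "i < j" using z(1) j less[of j i] i by (cases i j rule: linorder_cases) auto
      moreover have "j < Suc i"
        using z(2) j less[of "Suc i" j] by (cases j "Suc i" rule: linorder_cases) auto
      ultimately show False by simp
    qed
  qed simp
  moreover have "affine_piece {ts ! k..} (\<lambda>c. MIN e\<in>E. a e * c + b e)"
  proof (rule affine_piece_Min_between_crossings[OF E])
    fix d e assume de: "d \<in> E" "e \<in> E"
    show "(b e - b d) / (a d - a e) \<notin> interior {ts ! k..}" (is "?z \<notin> _")
    proof
      assume "?z \<in> interior {ts ! k..}"
      then have z: "ts ! k < ?z" by simp
      then have "?z \<in> B" using crossing[OF de] nonneg[OF in_B[of k]] by simp
      then obtain j where "j \<le> k" "?z = ts ! j" using index by blast
      then show False using z less[of j k] by (cases "j = k") auto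
    qed
  qed simp_all
  ultimately show ?thesis
    unfolding piecewise_linear_on_nonneg_def using t0 less
    by (intro exI[of _ k] exI[of _ "\<lambda>i. ts ! i"]) auto
qed

section \<open>Reduction of the minimax to finitely many mixed actions\<close>

text \<open>For \<open>u + v = 1\<close>, the convexity defect of \<open>x \<mapsto> x \<bullet> x\<close> equals \<open>u v (x - y) \<bullet> (x - y)\<close>.\<close>

lemma convex_on_inner_self:
  fixes S :: "'a::real_inner set"
  assumes "convex S"
  shows "convex_on S (\<lambda>x. x \<bullet> x)"
  unfolding convex_on_def
proof (intro conjI assms ballI allI impI)
  fix x y :: 'a and u v :: real
  assume uv: "0 \<le> u" "0 \<le> v" "u + v = 1"
  have v: "v = 1 - u" using uv by simp
  have "u * (x \<bullet> x) + v * (y \<bullet> y) - (u *\<^sub>R x + v *\<^sub>R y) \<bullet> (u *\<^sub>R x + v *\<^sub>R y)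
      = u * v * ((x - y) \<bullet> (x - y))"
    unfolding v by (simp add: inner_simps inner_commute algebra_simps)
  also have "\<dots> \<ge> 0" using uv by simp
  finally show "(u *\<^sub>R x + v *\<^sub>R y) \<bullet> (u *\<^sub>R x + v *\<^sub>R y) \<le> u * (x \<bullet> x) + v * (y \<bullet> y)"
    by simp
qed

lemma uniform_switching_cost:
  fixes y :: "real ^ 'n"
  assumes "y \<in> mixed_actions"
  shows "y \<bullet> (uniform_costs *v y) = 1 - y \<bullet> y"
proof -
  have total: "(\<Sum>j\<in>UNIV. y $ j) = 1" using assms by (simp add: mixed_actions_def)
  have "(uniform_costs *v y) $ i = 1 - y $ i" for i
  proof -
    have "(uniform_costs *v y) $ i = (\<Sum>j\<in>UNIV. y $ j - (if i = j then y $ j else 0))"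
      unfolding matrix_vector_mult_def uniform_costs_def vec_lambda_beta
      by (intro sum.cong) auto
    also have "\<dots> = 1 - y $ i" by (simp add: sum_subtractf total)
    finally show ?thesis .
  qed
  then have "y \<bullet> (uniform_costs *v y) = (\<Sum>i\<in>UNIV. y $ i - y $ i * y $ i)"
    by (simp add: inner_vec_def right_diff_distrib)
  also have "\<dots> = 1 - y \<bullet> y" by (simp add: sum_subtractf total inner_vec_def)
  finally show ?thesis .
qed

lemma inner_self_le_1_mixed_actions:
  assumes "y \<in> mixed_actions"
  shows "y \<bullet> y \<le> 1"
proof -
  have "norm y \<le> (\<Sum>i\<in>UNIV. \<bar>y $ i\<bar>)" by (rule norm_le_l1_cart)
  also have "\<dots> = 1" using assms by (simp add: mixed_actions_def)
  finally show ?thesis by (simp add: dot_square_norm power_le_one)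
qed

definition best_reply_region :: "real ^ 'n ^ 'm \<Rightarrow> 'm \<Rightarrow> (real ^ 'n) set" where
  "best_reply_region A i = {y \<in> mixed_actions. \<forall>k. (A *v y) $ k \<le> (A *v y) $ i}"

lemma polyhedron_mixed_actions: "polyhedron (mixed_actions :: (real ^ 'k) set)"
proof -
  have "(mixed_actions :: (real ^ 'k) set) =
      \<Inter> (range (\<lambda>i. {x. axis i 1 \<bullet> x \<ge> 0})) \<inter> {x. (\<chi> i. 1) \<bullet> x = 1}"
    by (auto simp: mixed_actions_def inner_axis' inner_vec_def[of "\<chi> i. 1"])
  also have "polyhedron \<dots>"
    by (intro polyhedron_Int polyhedron_Inter)
       (auto intro: polyhedron_halfspace_ge polyhedron_hyperplane)
  finally show ?thesis .
qed

lemma polytope_best_reply_region: "polytope (best_reply_region A i)"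
  unfolding polytope_eq_bounded_polyhedron
proof
  have "best_reply_region A i =
      mixed_actions \<inter> \<Inter> (range (\<lambda>k. {y. (A $ k - A $ i) \<bullet> y \<le> 0}))"
    by (auto simp: best_reply_region_def matrix_vector_mul_component inner_diff_left)
  also have "polyhedron \<dots>"
    by (intro polyhedron_Int polyhedron_Inter polyhedron_mixed_actions)
       (auto intro: polyhedron_halfspace_le)
  finally show "polyhedron (best_reply_region A i)" .
  show "bounded (best_reply_region A i)"
    by (rule bounded_subset[OF compact_imp_bounded[OF compact_mixed_actions]])
       (auto simp: best_reply_region_def)
qed

lemma static_guarantee_on_best_reply_region:
  assumes "y \<in> best_reply_region A i"
  shows "static_guarantee A uniform_costs c y = (A *v y) $ i + c * (1 - y \<bullet> y)"
proof -
  have "(MAX k. (A *v y) $ k) = (A *v y) $ i"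
    using assms by (intro Max_eqI) (auto simp: best_reply_region_def)
  with assms show ?thesis
    by (simp add: static_guarantee_eq_Max uniform_switching_cost best_reply_region_def)
qed

lemma concave_on_static_guarantee:
  assumes "0 \<le> c"
  shows "concave_on (best_reply_region A i) (static_guarantee A uniform_costs c)"
proof -
  have conv: "convex (best_reply_region A i)"
    by (rule polytope_imp_convex[OF polytope_best_reply_region])
  have "concave_on (best_reply_region A i) (\<lambda>y. (A *v y) $ i + c * (1 - y \<bullet> y))"
  proof (intro concave_on_add concave_on_cmul concave_on_diff convex_on_inner_self conv assms)
    show "concave_on (best_reply_region A i) (\<lambda>y. (A *v y) $ i)"
      using conv by (simp add: concave_on_iff matrix_vector_right_distrib matrix_vector_mult_scaleR)
    show "concave_on (best_reply_region A i) (\<lambda>y. 1)"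
      using conv by (simp add: concave_on_const)
  qed
  then show ?thesis
    unfolding concave_on_iff
    using convexD[OF conv] by (metis static_guarantee_on_best_reply_region)
qed

text \<open>A concave function on a polytope is bounded below by its least value on a finite spanning set.
  The order of the quantifiers is what makes this useful: the spanning sets of the best reply
  regions come from \<open>A\<close> alone, so one \<open>E\<close> serves all \<open>c\<close>.\<close>

lemma static_value_eq_Min:
  fixes A :: "real ^ 'n ^ 'm"
  obtains E where "finite E" "E \<noteq> {}" "E \<subseteq> mixed_actions"
    "\<And>c. 0 \<le> c \<Longrightarrow> static_value A uniform_costs c
        = (MIN e\<in>E. (1 - e \<bullet> e) * c + (MAX i. (A *v e) $ i))"
proof -
  have "\<forall>i. \<exists>V. finite V \<and> best_reply_region A i = convex hull V"
    using polytope_best_reply_region[of A] unfolding polytope_def by blast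
  then obtain V where V: "\<And>i. finite (V i)" "\<And>i. best_reply_region A i = convex hull V i"
    by metis
  define E where "E = (\<Union>i. V i)"
  have fin: "finite E" using V(1) by (simp add: E_def)
  have V_region: "V i \<subseteq> best_reply_region A i" for i by (simp add: V(2) hull_subset)
  then have sub: "E \<subseteq> mixed_actions" by (auto simp: E_def best_reply_region_def)
  have cover: "\<exists>i. y \<in> best_reply_region A i" if "y \<in> mixed_actions" for y
  proof -
    have "(MAX k. (A *v y) $ k) \<in> range (\<lambda>k. (A *v y) $ k)" by (intro Max_in) auto
    then obtain i where i: "(MAX k. (A *v y) $ k) = (A *v y) $ i" by (rule imageE)
    have "(A *v y) $ k \<le> (A *v y) $ i" for k by (simp flip: i)
    with that show ?thesis by (auto simp: best_reply_region_def)
  qed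
  obtain y0 :: "real ^ 'n" where "y0 \<in> mixed_actions" using mixed_actions_nonempty by blast
  with cover obtain i0 where "y0 \<in> convex hull V i0" using V(2) by blast
  then have "V i0 \<noteq> {}" by auto
  then have ne: "E \<noteq> {}" by (auto simp: E_def)
  have "static_value A uniform_costs c
      = (MIN e\<in>E. (1 - e \<bullet> e) * c + (MAX i. (A *v e) $ i))" if c: "0 \<le> c" for c
  proof -
    let ?g = "static_guarantee A uniform_costs c"
    obtain y where y: "y \<in> mixed_actions" "?g y = static_value A uniform_costs c"
      and y_min: "\<And>y'. y' \<in> mixed_actions \<Longrightarrow> ?g y \<le> ?g y'"
      using static_value_is_min[of A uniform_costs c] by blast
    obtain i where i: "y \<in> convex hull V i" using cover[OF y(1)] V(2) by blast
    have lower: "Min (?g ` E) \<le> ?g v" if "v \<in> V i" for v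
      using fin that by (intro Min_le) (auto simp: E_def)
    have "convex_on (convex hull V i) (\<lambda>y. - ?g y)"
      using concave_on_static_guarantee[OF c, of A i] by (simp add: V(2) concave_on_def)
    from convex_on_convex_hull_bound[OF this, of "- Min (?g ` E)"] lower i
    have "Min (?g ` E) \<le> ?g y" by force
    moreover have "?g y \<le> Min (?g ` E)"
      using fin ne sub y_min by (auto simp: Min_ge_iff)
    ultimately have "static_value A uniform_costs c = Min (?g ` E)" using y(2) by simp
    also have "?g ` E = (\<lambda>e. (1 - e \<bullet> e) * c + (MAX i. (A *v e) $ i)) ` E"
      using sub
      by (intro image_cong) (auto simp: static_guarantee_eq_Max uniform_switching_cost mult.commute)
    finally show ?thesis .
  qed
  with fin ne sub show ?thesis by (rule that)
qed

section \<open>Shape of the static value\<close>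

lemma piecewise_linear_on_nonneg_cong:
  assumes g: "piecewise_linear_on_nonneg g" and eq: "\<And>c. 0 \<le> c \<Longrightarrow> f c = g c"
  shows "piecewise_linear_on_nonneg f"
proof -
  obtain k :: nat and t where t: "t 0 = 0" "\<forall>i<k. t i < t (Suc i)"
    and pieces: "\<forall>i<k. affine_piece {t i..t (Suc i)} g" "affine_piece {t k..} g"
    using g unfolding piecewise_linear_on_nonneg_def by (elim exE conjE) (rule that)
  have nonneg: "0 \<le> t i" if "i \<le> k" for i
    using that
  proof (induction i)
    case (Suc i)
    then have "0 \<le> t i" "t i < t (Suc i)" using t(2) by auto
    then show ?case by simp
  qed (simp add: t)
  have piece: "affine_piece I f" if "affine_piece I g" "I \<subseteq> {0..}" for I
    using that eq unfolding affine_piece_def by (metis atLeast_iff subsetD)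
  have "affine_piece {t i..t (Suc i)} f" if "i < k" for i
    using piece[of "{t i..t (Suc i)}"] pieces(1) nonneg[of i] that by auto
  moreover have "affine_piece {t k..} f"
    using piece[of "{t k..}"] pieces(2) nonneg[of k] by auto
  ultimately show ?thesis
    unfolding piecewise_linear_on_nonneg_def using t by (intro exI[of _ k] exI[of _ t]) simp
qed

theorem proposition7:
  fixes A :: "real ^ 'n ^ 'm"
  shows "continuous_on {0..} (static_value A uniform_costs) \<and>
         mono_on {0..} (static_value A uniform_costs) \<and>
         concave_on {0..} (static_value A uniform_costs) \<and>
         piecewise_linear_on_nonneg (static_value A uniform_costs)"
proof -
  obtain E :: "(real ^ 'n) set" where E: "finite E" "E \<noteq> {}" "E \<subseteq> mixed_actions"
    and value_eq: "\<And>c. 0 \<le> c \<Longrightarrow> static_value A uniform_costs c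
        = (MIN e\<in>E. (1 - e \<bullet> e) * c + (MAX i. (A *v e) $ i))"
    using static_value_eq_Min[of A] by blast
  define f where "f c = (MIN e\<in>E. (1 - e \<bullet> e) * c + (MAX i. (A *v e) $ i))" for c
  have eq: "static_value A uniform_costs c = f c" if "0 \<le> c" for c
    using value_eq[OF that] by (simp add: f_def)
  have "continuous_on {0..} f"
    unfolding f_def using E by (intro continuous_on_Min continuous_intros)
  then have "continuous_on {0..} (static_value A uniform_costs)"
    by (rule continuous_on_eq) (simp add: eq)
  moreover have "mono_on {0..} f"
    unfolding f_def
  proof (rule mono_on_Min[OF E(1,2)])
    fix e assume "e \<in> E"
    then have "0 \<le> 1 - e \<bullet> e" using E(3) inner_self_le_1_mixed_actions[of e] by auto
    then show "mono_on {0..} (\<lambda>c. (1 - e \<bullet> e) * c + (MAX i. (A *v e) $ i))"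
      by (intro mono_onI add_right_mono mult_left_mono)
  qed
  then have "mono_on {0..} (static_value A uniform_costs)"
    by (simp add: eq monotone_on_def)
  moreover have "concave_on {0..} f"
    unfolding f_def
  proof (rule concave_on_Min[OF E(1,2)])
    fix e :: "real ^ 'n"
    show "concave_on {0..} (\<lambda>c. (1 - e \<bullet> e) * c + (MAX i. (A *v e) $ i))"
      by (intro concave_on_linorderI) (auto simp: algebra_simps)
  qed
  then have "concave_on {0..} (static_value A uniform_costs)"
    by (simp add: concave_on_iff eq)
  moreover have "piecewise_linear_on_nonneg (static_value A uniform_costs)"
    using piecewise_linear_on_nonneg_Min[OF E(1,2)] value_eq
    by (rule piecewise_linear_on_nonneg_cong)
  ultimately show ?thesis by simp
qed

end
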